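(* Let $\alpha\geq 1$. Then: (1) $S_n$ has the maximum value of $Pl_\alpha$ among all $n$-vertex trees; (2) $S_n^+$ has the maximum value of $Pl_\alpha$ among all $n$-vertex unicyclic graphs; (3) $B_1$ has the maximum value of $Pl_\alpha$ among all $n$-vertex bicyclic graphs; (4) for $n\geq 5$, the maximum value of $Pl_\alpha$ among all $n$-vertex tricyclic graphs is attained by $G_4$ or $G_5$; more precisely, $Pl_\alpha(G_4)<Pl_\alpha(G_5)$ for $1<\alpha<2$, $Pl_\alpha(G_4)>Pl_\alpha(G_5)$ for $\alpha>2$, and $Pl_\alpha(G_4)=Pl_\alpha(G_5)$ for $\alpha\in\{1,2\}$; (5) for $n\geq 6$, $H_4$ has the maximum value of $Pl_\alpha$ among all $n$-vertex tetracyclic graphs, and for $n=5$, $H_5$ has the maximum value of $Pl_\alpha$ among all $5$-vertex tetracyclic graphs.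
   Context: All graphs are finite, simple, undirected and connected. A connected graph with $n$ vertices and $m$ edges is a tree, unicyclic, bicyclic, tricyclic, tetracyclic graph if $m=n-1,n,n+1,n+2,n+3$ respectively. The general Platt index is $Pl_\alpha(G)=\sum_{uv\in E(G)}(d_u+d_v-2)^\alpha$, $d_u$ the degree of $u$. $S_n$ is the star on $n$ vertices. The following graphs are obtained from $S_n$ by adding edges between leaves: $S_n^+$: add one edge; $B_1$: add two edges sharing a common leaf; $G_4$: join one leaf to three other leaves (requires $n\ge5$); $G_5$: add the three edges of a triangle on three leaves; $H_4$: join one leaf to four other leaves (requires $n\ge6$); $H_5$: add on four leaves $v_1,\dots,v_4$ the edges $v_1v_2,v_2v_3,v_3v_1,v_1v_4$. Statements (1)–(3) are for those $n$ for which the respective graphs exist. *)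

theory Defs
  imports Complex_Main
begin

text \<open>Finite simple undirected graphs: vertex set V, edge set E of 2-element subsets of V.\<close>

definition simple_graph :: "'a set \<Rightarrow> 'a set set \<Rightarrow> bool" where
  "simple_graph V E \<longleftrightarrow> finite V \<and> (\<forall>e\<in>E. \<exists>u v. e = {u, v} \<and> u \<noteq> v \<and> u \<in> V \<and> v \<in> V)"

definition adj_rel :: "'a set set \<Rightarrow> ('a \<times> 'a) set" where
  "adj_rel E = {(u, v). {u, v} \<in> E}"

definition connected_graph :: "'a set \<Rightarrow> 'a set set \<Rightarrow> bool" where
  "connected_graph V E \<longleftrightarrow> simple_graph V E \<and> V \<noteq> {} \<and>
     (\<forall>u\<in>V. \<forall>v\<in>V. (u, v) \<in> (adj_rel E)\<^sup>*)"

definition deg :: "'a set set \<Rightarrow> 'a \<Rightarrow> nat" where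
  "deg E v = card {e \<in> E. v \<in> e}"

text \<open>General Platt index: sum over edges uv of (d_u + d_v - 2)^alpha.\<close>
definition platt :: "real \<Rightarrow> 'a set set \<Rightarrow> real" where
  "platt \<alpha> E = (\<Sum>e\<in>E. (real (\<Sum>v\<in>e. deg E v) - 2) powr \<alpha>)"

text \<open>Connected graph with n vertices and n - 1 + k edges (k = 0: tree, 1: unicyclic, ...).\<close>
definition cyclic_class :: "nat \<Rightarrow> nat \<Rightarrow> 'a set \<Rightarrow> 'a set set \<Rightarrow> bool" where
  "cyclic_class k n V E \<longleftrightarrow> connected_graph V E \<and> card V = n \<and> card E + 1 = n + k"

abbreviation "is_tree n V E \<equiv> cyclic_class 0 n V E"
abbreviation "is_unicyclic n V E \<equiv> cyclic_class 1 n V E"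
abbreviation "is_bicyclic n V E \<equiv> cyclic_class 2 n V E"
abbreviation "is_tricyclic n V E \<equiv> cyclic_class 3 n V E"
abbreviation "is_tetracyclic n V E \<equiv> cyclic_class 4 n V E"

text \<open>Concrete graphs on vertex set {0..<n}; 0 is the centre of the star, 1..n-1 the leaves.\<close>
definition verts :: "nat \<Rightarrow> nat set" where "verts n = {0..<n}"

definition star_E :: "nat \<Rightarrow> nat set set" where
  "star_E n = {{0, i} | i. 1 \<le> i \<and> i < n}"

definition Splus_E :: "nat \<Rightarrow> nat set set" where
  "Splus_E n = star_E n \<union> {{1, 2}}"

definition B1_E :: "nat \<Rightarrow> nat set set" where
  "B1_E n = star_E n \<union> {{1, 2}, {1, 3}}"

definition G4_E :: "nat \<Rightarrow> nat set set" where
  "G4_E n = star_E n \<union> {{1, 2}, {1, 3}, {1, 4}}"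

definition G5_E :: "nat \<Rightarrow> nat set set" where
  "G5_E n = star_E n \<union> {{1, 2}, {2, 3}, {1, 3}}"

definition H4_E :: "nat \<Rightarrow> nat set set" where
  "H4_E n = star_E n \<union> {{1, 2}, {1, 3}, {1, 4}, {1, 5}}"

definition H5_E :: "nat \<Rightarrow> nat set set" where
  "H5_E n = star_E n \<union> {{1, 2}, {2, 3}, {3, 1}, {1, 4}}"

end

theory Submission
  imports Defs "HOL-Analysis.Convex"
begin

text \<open>Let \<open>u\<close> and \<open>v\<close> be vertices that are adjacent or have a common neighbour. Moving to \<open>u\<close> all
  neighbours of \<open>v\<close> that \<open>u\<close> lacks (a Kelmans shift) keeps the graph connected and, by convexity of
  \<open>x powr \<alpha>\<close>, does not decrease the index. It increases the sum of the squared degrees unless the two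
  neighbourhoods are nested, so the index need only be bounded for graphs in which they are always
  nested. Such a graph has a vertex adjacent to all others, and its remaining \<open>k\<close> edges consist of a
  star from some leaf \<open>w\<close> to a set \<open>A\<close> and of pairs within \<open>A\<close>. For \<open>k \<le> 4\<close> this leaves only the listed
  graphs, whose indices are compared by finite differences of \<open>x powr \<alpha>\<close>.\<close>

section \<open>Neighbourhoods\<close>

definition nbrs :: "'a set set \<Rightarrow> 'a \<Rightarrow> 'a set" where
  "nbrs E x = {y. {x, y} \<in> E}"

lemma mem_nbrs: "y \<in> nbrs E x \<longleftrightarrow> {x, y} \<in> E"
  by (simp add: nbrs_def)

lemma nbrs_sym: "y \<in> nbrs E x \<longleftrightarrow> x \<in> nbrs E y"
  by (simp add: nbrs_def insert_commute)

context
  fixes V :: "'a set" and E :: "'a set set"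
  assumes G: "simple_graph V E"
begin

lemma edgeE:
  assumes "e \<in> E"
  obtains x y where "e = {x, y}" "x \<noteq> y" "x \<in> V" "y \<in> V"
  using G assms unfolding simple_graph_def by blast

lemma edge_ne: "{x, y} \<in> E \<Longrightarrow> x \<noteq> y"
  by (erule edgeE) (auto simp: doubleton_eq_iff)

lemma edge_verts: "{x, y} \<in> E \<Longrightarrow> x \<in> V \<and> y \<in> V"
  by (erule edgeE) (auto simp: doubleton_eq_iff)

lemma edges_subset_Pow: "E \<subseteq> Pow V"
  using edgeE by blast

lemma finite_verts: "finite V"
  using G by (simp add: simple_graph_def)

lemma finite_edges: "finite E"
  using edges_subset_Pow finite_verts by (meson finite_Pow_iff finite_subset)

lemma nbrs_subset: "nbrs E x \<subseteq> V"
  using edge_verts by (auto simp: nbrs_def)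

lemma not_self_nbr: "x \<notin> nbrs E x"
  using edge_ne[of x x] by (auto simp: nbrs_def)

lemma finite_nbrs: "finite (nbrs E x)"
  using nbrs_subset finite_verts by (rule finite_subset)

lemma edge_cases:
  assumes "e \<in> E" "x \<in> e"
  obtains y where "e = {x, y}" "y \<in> nbrs E x"
proof -
  obtain a b where ab: "e = {a, b}" using assms(1) by (rule edgeE)
  with assms(2) consider "e = {x, b}" | "e = {x, a}" by (auto simp: insert_commute)
  then show ?thesis using assms(1) that by cases (auto simp: nbrs_def)
qed

lemma edges_at: "{e \<in> E. x \<in> e} = (\<lambda>y. {x, y}) ` nbrs E x"
  by (auto simp: nbrs_def elim: edge_cases)

lemma edges_at_avoiding: "{e \<in> E. x \<in> e \<and> z \<notin> e} = (\<lambda>y. {x, y}) ` (nbrs E x - {z})" if "z \<noteq> x"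
  using that by (auto simp: nbrs_def elim: edge_cases)

lemma deg_nbrs: "deg E x = card (nbrs E x)"
  unfolding deg_def edges_at by (intro card_image) (auto simp: inj_on_def doubleton_eq_iff)

lemma deg_pos: "{x, y} \<in> E \<Longrightarrow> deg E x > 0"
  using finite_nbrs by (auto simp: deg_nbrs card_gt_0_iff mem_nbrs)

lemma sum_edge: "{x, y} \<in> E \<Longrightarrow> (\<Sum>v\<in>{x, y}. deg E v) = deg E x + deg E y"
  using edge_ne by simp

text \<open>A shift between \<open>u\<close> and \<open>v\<close> affects differently the edges with
  both or neither end in the pair and those with exactly one. Grouping the index this way lets each
  group be compared on its own.\<close>

lemma platt_split:
  assumes "u \<noteq> v"
  shows "platt \<alpha> E =
     (\<Sum>e\<in>{e \<in> E. u \<in> e \<longleftrightarrow> v \<in> e}. (real (\<Sum>x\<in>e. deg E x) - 2) powr \<alpha>)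
   + (\<Sum>x\<in>nbrs E u - {v}. (real (deg E u + deg E x) - 2) powr \<alpha>)
   + (\<Sum>x\<in>nbrs E v - {u}. (real (deg E v + deg E x) - 2) powr \<alpha>)"
proof -
  let ?f = "\<lambda>e. (real (\<Sum>x\<in>e. deg E x) - 2) powr \<alpha>"
  have half: "(\<Sum>e\<in>{e \<in> E. p \<in> e \<and> q \<notin> e}. ?f e) =
      (\<Sum>x\<in>nbrs E p - {q}. (real (deg E p + deg E x) - 2) powr \<alpha>)" if "q \<noteq> p" for p q
  proof -
    have "(\<Sum>e\<in>{e \<in> E. p \<in> e \<and> q \<notin> e}. ?f e) = (\<Sum>x\<in>nbrs E p - {q}. ?f {p, x})"
      unfolding edges_at_avoiding[OF that]
      by (subst sum.reindex) (auto simp: inj_on_def doubleton_eq_iff)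
    also have "\<dots> = (\<Sum>x\<in>nbrs E p - {q}. (real (deg E p + deg E x) - 2) powr \<alpha>)"
      by (intro sum.cong refl) (auto simp: mem_nbrs sum_edge)
    finally show ?thesis .
  qed
  have "E = {e \<in> E. u \<in> e \<longleftrightarrow> v \<in> e} \<union> {e \<in> E. u \<in> e \<and> v \<notin> e} \<union> {e \<in> E. v \<in> e \<and> u \<notin> e}"
    by auto
  then have "platt \<alpha> E = (\<Sum>e\<in>{e \<in> E. u \<in> e \<longleftrightarrow> v \<in> e} \<union> {e \<in> E. u \<in> e \<and> v \<notin> e}
      \<union> {e \<in> E. v \<in> e \<and> u \<notin> e}. ?f e)"
    unfolding platt_def by simp
  also have "\<dots> = sum ?f {e \<in> E. u \<in> e \<longleftrightarrow> v \<in> e} + sum ?f {e \<in> E. u \<in> e \<and> v \<notin> e}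
      + sum ?f {e \<in> E. v \<in> e \<and> u \<notin> e}"
    using finite_edges by (subst sum.union_disjoint; (auto simp: sum.union_disjoint))+
  finally show ?thesis
    using half[of v u] half[of u v] assms by simp
qed

end

section \<open>Convexity of \<open>x powr \<alpha>\<close> on the closed half-line\<close>

text \<open>Between positive points this is the usual convexity. The endpoint 0 is included because
  \<open>powr_spread\<close> admits it as its smallest argument.\<close>

lemma convex_on_powr_nonneg:
  fixes \<alpha> :: real
  assumes "\<alpha> \<ge> 1"
  shows "convex_on {0..} (\<lambda>x::real. x powr \<alpha>)"
proof (rule convex_onI)
  fix t x y :: real
  assume t: "0 < t" "t < 1" and xy: "x \<in> {0..}" "y \<in> {0..}"
  \<comment> \<open>If one of the two points is 0, whose power is 0, convexity reduces to this
    inequality.\<close>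
  have scale: "(s * z) powr \<alpha> \<le> s * z powr \<alpha>" if "0 < s" "s < 1" "0 \<le> z" for s z :: real
  proof -
    have "s powr \<alpha> \<le> s powr 1" using that assms by (intro powr_mono') auto
    then show ?thesis using that by (simp add: powr_mult mult_right_mono)
  qed
  consider "x = 0" | "y = 0" | "x > 0" "y > 0" using xy by fastforce
  then show "((1 - t) *\<^sub>R x + t *\<^sub>R y) powr \<alpha> \<le> (1 - t) * x powr \<alpha> + t * y powr \<alpha>"
  proof cases
    case 3
    then show ?thesis using convex_onD[OF powr_convex[OF assms], of t x y] t by simp
  qed (use scale t xy in auto)
qed simp

text \<open>The hypotheses place \<open>a\<close> and \<open>b\<close> symmetrically in the interval
  from \<open>b'\<close> to \<open>a'\<close>. They are thus convex combinations of its ends with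
  the weights \<open>t\<close> and \<open>1 - t\<close> interchanged, and adding the two convexity
  inequalities cancels the weights.\<close>

lemma powr_spread:
  fixes a b a' b' \<alpha> :: real
  assumes "\<alpha> \<ge> 1" "a + b = a' + b'" "a \<le> a'" "b \<le> a'" "0 \<le> b'"
  shows "a powr \<alpha> + b powr \<alpha> \<le> a' powr \<alpha> + b' powr \<alpha>"
proof (cases "a' = b'")
  case True
  then have "a = a'" "b = b'" using assms by auto
  then show ?thesis by simp
next
  case False
  define t where "t = (a - b') / (a' - b')"
  have pos: "a' - b' > 0" using assms False by argo
  have t: "0 \<le> t" "t \<le> 1" using pos assms by (auto simp: t_def field_simps)
  have t': "t * (a' - b') = a - b'" using pos by (simp add: t_def)
  have c: "convex_on {0..} (\<lambda>x::real. x powr \<alpha>)"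
    using assms(1) by (rule convex_on_powr_nonneg)
  have 1: "a powr \<alpha> \<le> (1 - t) * b' powr \<alpha> + t * a' powr \<alpha>"
    using convex_onD[OF c t, of b' a'] assms t' pos by (simp add: algebra_simps)
  have 2: "b powr \<alpha> \<le> t * b' powr \<alpha> + (1 - t) * a' powr \<alpha>"
  proof -
    have "b = t * b' + (1 - t) * a'" using assms t' by (simp add: algebra_simps)
    then show ?thesis using convex_onD[OF c, of "1 - t" b' a'] t assms pos by simp
  qed
  from 1 2 show ?thesis by (simp add: algebra_simps)
qed

section \<open>Kelmans shifts\<close>

text \<open>The vertex \<open>u\<close> is removed because an edge between \<open>u\<close> and
  \<open>v\<close> would otherwise be turned into a loop at \<open>u\<close> by the shift.\<close>

definition priv :: "'a set set \<Rightarrow> 'a \<Rightarrow> 'a \<Rightarrow> 'a set" where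
  "priv E v u = nbrs E v - nbrs E u - {u}"

definition shift :: "'a set set \<Rightarrow> 'a \<Rightarrow> 'a \<Rightarrow> 'a set set" where
  "shift E u v = (E - (\<lambda>x. {v, x}) ` priv E v u) \<union> (\<lambda>x. {u, x}) ` priv E v u"

context
  fixes V :: "'a set" and E :: "'a set set" and u v :: 'a
  assumes G: "simple_graph V E" and uv: "u \<noteq> v" and uV: "u \<in> V"
begin

lemma priv_ne: "x \<in> priv E v u \<Longrightarrow> x \<noteq> u \<and> x \<noteq> v"
  using not_self_nbr[OF G] by (auto simp: priv_def)

lemma simple_shift: "simple_graph V (shift E u v)"
proof -
  have "priv E v u \<subseteq> V - {u}" using nbrs_subset[OF G] by (auto simp: priv_def)
  then have "\<exists>x y. e = {x, y} \<and> x \<noteq> y \<and> x \<in> V \<and> y \<in> V" if "e \<in> shift E u v" for e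
  proof -
    consider "e \<in> E" | z where "z \<in> priv E v u" "e = {u, z}"
      using \<open>e \<in> shift E u v\<close> by (auto simp: shift_def)
    then show ?thesis
    proof cases
      case 1
      then show ?thesis by (meson edgeE[OF G])
    next
      case 2
      then show ?thesis using \<open>priv E v u \<subseteq> V - {u}\<close> uV by blast
    qed
  qed
  then show ?thesis
    using finite_verts[OF G] by (simp add: simple_graph_def)
qed

lemma card_shift: "card (shift E u v) = card E"
proof -
  let ?A = "priv E v u"
  have inj: "card ((\<lambda>x. {w, x}) ` ?A) = card ?A" for w
    by (intro card_image) (auto simp: inj_on_def doubleton_eq_iff)
  have fA: "finite ?A" using finite_nbrs[OF G] by (simp add: priv_def)
  have sub: "(\<lambda>x. {v, x}) ` ?A \<subseteq> E" by (auto simp: priv_def mem_nbrs)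
  \<comment> \<open>The edges added are really new, since a private neighbour of \<open>v\<close> is
    not adjacent to \<open>u\<close>.\<close>
  have "(E - (\<lambda>x. {v, x}) ` ?A) \<inter> (\<lambda>x. {u, x}) ` ?A = {}"
    by (auto simp: priv_def mem_nbrs)
  then have "card (shift E u v) = card (E - (\<lambda>x. {v, x}) ` ?A) + card ?A"
    using fA finite_edges[OF G] inj unfolding shift_def by (subst card_Un_disjoint) auto
  also have "\<dots> = card E"
    using fA sub inj[of v] card_mono[OF finite_edges[OF G] sub] by (simp add: card_Diff_subset)
  finally show ?thesis .
qed

lemma doubleton_mem_image: "{x, y} \<in> (\<lambda>z. {w, z}) ` A \<longleftrightarrow> x = w \<and> y \<in> A \<or> y = w \<and> x \<in> A"
  by (auto simp: doubleton_eq_iff)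

lemma mem_nbrs_shift: "y \<in> nbrs (shift E u v) x \<longleftrightarrow>
    y \<in> nbrs E x \<and> \<not> (x = v \<and> y \<in> priv E v u \<or> y = v \<and> x \<in> priv E v u) \<or>
    x = u \<and> y \<in> priv E v u \<or> y = u \<and> x \<in> priv E v u"
  by (simp add: mem_nbrs shift_def doubleton_mem_image)

lemma nbrs_shift_u: "nbrs (shift E u v) u = nbrs E u \<union> priv E v u"
  using uv priv_ne[of u] priv_ne[of v] by (auto simp: mem_nbrs_shift)

lemma nbrs_shift_v: "nbrs (shift E u v) v = nbrs E v - priv E v u"
  using uv priv_ne[of u] priv_ne[of v] by (auto simp: mem_nbrs_shift)

lemma nbrs_shift_other:
  assumes "x \<noteq> u" "x \<noteq> v"
  shows "nbrs (shift E u v) x = (if x \<in> priv E v u then insert u (nbrs E x - {v}) else nbrs E x)"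
  using uv assms priv_ne by (auto simp: mem_nbrs_shift)

text \<open>A private neighbour of \<open>v\<close> trades \<open>v\<close> for \<open>u\<close>,
  which it was not adjacent to before; every other vertex outside the pair keeps its
  neighbourhood.\<close>

lemma deg_shift_other:
  assumes "x \<noteq> u" "x \<noteq> v"
  shows "deg (shift E u v) x = deg E x"
proof (cases "x \<in> priv E v u")
  case True
  then have "v \<in> nbrs E x" "u \<notin> nbrs E x"
    by (simp_all add: priv_def mem_nbrs insert_commute)
  then show ?thesis
    using True finite_nbrs[OF G, of x] assms uv card_Suc_Diff1[of "nbrs E x" v]
    by (simp add: deg_nbrs[OF G] deg_nbrs[OF simple_shift] nbrs_shift_other)
qed (use assms in \<open>simp add: deg_nbrs[OF G] deg_nbrs[OF simple_shift] nbrs_shift_other\<close>)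

text \<open>Both neighbourhoods split into a private part, the common part \<open>C\<close> and at
  most one vertex due to an edge \<open>uv\<close>; the shift moves \<open>A\<close> from
  \<open>v\<close> to \<open>u\<close>. The degree comparisons for shifts are read off from these
  equations, among them that the degree sum of \<open>u\<close> and \<open>v\<close> is
  preserved.\<close>

lemma card_parts:
  fixes A B C :: "'a set"
  defines "A \<equiv> priv E v u" and "B \<equiv> priv E u v" and "C \<equiv> nbrs E u \<inter> nbrs E v"
  defines "s \<equiv> (of_bool ({u, v} \<in> E) :: nat)"
  shows "deg E u = card B + card C + s" "deg E v = card A + card C + s"
    "deg (shift E u v) u = card A + card B + card C + s" "deg (shift E u v) v = card C + s"
proof -
  \<comment> \<open>\<open>S v\<close> is what the edge \<open>uv\<close>, if present, adds to the
    neighbourhood of \<open>u\<close>, and \<open>S u\<close> what it adds to that of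
    \<open>v\<close>.\<close>
  define S where "S w = (if {u, v} \<in> E then {w} else {})" for w :: 'a
  have fin: "finite A" "finite B" "finite C" and S: "finite (S w)" "card (S w) = s" for w
    using finite_nbrs[OF G] by (auto simp: A_def B_def C_def priv_def S_def s_def)
  have nu: "nbrs E u = B \<union> C \<union> S v" and nv: "nbrs E v = A \<union> C \<union> S u"
    by (auto simp: A_def B_def C_def S_def priv_def nbrs_def insert_commute)
  have disj: "A \<inter> B = {}" "A \<inter> C = {}" "B \<inter> C = {}"
    and nS: "u \<notin> A \<union> B \<union> C" "v \<notin> A \<union> B \<union> C"
    using not_self_nbr[OF G] by (auto simp: A_def B_def C_def priv_def)
  have nS': "X \<inter> S u = {}" "X \<inter> S v = {}" if "X \<subseteq> A \<union> B \<union> C" for X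
    using that nS by (auto simp: S_def)
  have nu': "nbrs (shift E u v) u = A \<union> B \<union> C \<union> S v"
    unfolding nbrs_shift_u nu by (auto simp: A_def)
  have nv': "nbrs (shift E u v) v = C \<union> S u"
    unfolding nbrs_shift_v nv using disj nS by (auto simp: A_def S_def)
  have un: "card (X \<union> S w) = card X + s" if "X \<subseteq> A \<union> B \<union> C" "w \<in> {u, v}" for X w
    using that nS'[of X] S fin finite_subset[OF that(1)] by (subst card_Un_disjoint) auto
  have two: "card (B \<union> C) = card B + card C" "card (A \<union> C) = card A + card C"
    "card (A \<union> B \<union> C) = card A + card B + card C"
    using fin disj by (auto simp: card_Un_disjoint Int_Un_distrib2)
  show "deg E u = card B + card C + s" "deg E v = card A + card C + s"
    "deg (shift E u v) u = card A + card B + card C + s" "deg (shift E u v) v = card C + s"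
    unfolding deg_nbrs[OF G] deg_nbrs[OF simple_shift] nu nv nu' nv'
    using two un[of "B \<union> C" v] un[of "A \<union> C" u] un[of "A \<union> B \<union> C" v] un[of C u] by auto
qed

text \<open>Edges avoiding both \<open>u\<close> and \<open>v\<close>, and the edge
  \<open>uv\<close>, keep their degree sums. Edges to \<open>A\<close> and \<open>B\<close> end up
  at \<open>u\<close>, whose new degree is at least both old ones. For \<open>x\<close> in
  \<open>C\<close> the two edges at \<open>x\<close> change together: their degree sums keep the
  same total but move apart, so \<open>powr_spread\<close> applies.\<close>

lemma platt_shift:
  assumes "\<alpha> \<ge> 1"
  shows "platt \<alpha> E \<le> platt \<alpha> (shift E u v)"
proof -
  define A where "A = priv E v u"
  define B where "B = priv E u v"
  define C where "C = nbrs E u \<inter> nbrs E v"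
  define E' where "E' = shift E u v"
  note d = card_parts[folded A_def B_def C_def E'_def]
  have fin: "finite A" "finite B" "finite C"
    using finite_nbrs[OF G] by (auto simp: A_def B_def C_def priv_def)
  have disj: "A \<inter> B = {}" "A \<inter> C = {}" "B \<inter> C = {}"
    by (auto simp: A_def B_def C_def priv_def)
  have ne: "x \<noteq> u \<and> x \<noteq> v" if "x \<in> A \<union> B \<union> C" for x
    using that not_self_nbr[OF G] by (auto simp: A_def B_def C_def priv_def)
  have nu: "nbrs E u - {v} = B \<union> C" and nv: "nbrs E v - {u} = A \<union> C"
    and nu': "nbrs E' u - {v} = A \<union> B \<union> C" and nv': "nbrs E' v - {u} = C"
    unfolding E'_def nbrs_shift_u nbrs_shift_v using not_self_nbr[OF G]
    by (auto simp: A_def B_def C_def priv_def)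
  let ?R = "{e \<in> E. u \<in> e \<longleftrightarrow> v \<in> e}"
  let ?p = "\<lambda>E e. (real (\<Sum>x\<in>e. deg E x) - 2) powr \<alpha>"
  let ?q = "\<lambda>E w x. (real (deg E w + deg E x) - 2) powr \<alpha>"
  have R: "{e \<in> E'. u \<in> e \<longleftrightarrow> v \<in> e} = ?R"
    using ne uv by (auto simp: E'_def shift_def A_def)
  have Rsum: "sum (?p E') ?R = sum (?p E) ?R"
  proof (rule sum.cong[OF refl])
    fix e assume e: "e \<in> ?R"
    then obtain x y where xy: "e = {x, y}" "x \<noteq> y" using edgeE[OF G] by blast
    have "sum (deg E') e = sum (deg E) e"
    proof (cases "u \<in> e")
      case True
      then have "e = {u, v}" using e xy uv by auto
      then show ?thesis using d uv by simp
    next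
      case False
      then show ?thesis using e
        by (intro sum.cong refl) (metis (lifting) mem_Collect_eq E'_def deg_shift_other)
    qed
    then show "?p E' e = ?p E e" by simp
  qed
  have deg_eq: "deg E' x = deg E x" if "x \<in> A \<union> B \<union> C" for x
    using ne[OF that] by (simp add: E'_def deg_shift_other)
  have le_u: "deg E u \<le> deg E' u" and le_v: "deg E v \<le> deg E' u"
    and bal: "deg E u + deg E v = deg E' u + deg E' v" using d by auto
  \<comment> \<open>Ends of an edge have degree at least 1, so the bases of the powers are not
    negative, as monotonicity of \<open>powr\<close> requires.\<close>
  have low: "deg E x \<ge> 1" "deg E u \<ge> 1" if "x \<in> B \<union> C" for x
    using that deg_pos[OF G, of u x] deg_pos[OF G, of x u]
    by (auto simp: B_def C_def priv_def mem_nbrs insert_commute Suc_le_eq)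
  have low': "deg E x \<ge> 1" "deg E v \<ge> 1" if "x \<in> A \<union> C" for x
    using that deg_pos[OF G, of v x] deg_pos[OF G, of x v]
    by (auto simp: A_def C_def priv_def mem_nbrs insert_commute Suc_le_eq)
  have "sum (?q E u) B \<le> sum (?q E' u) B"
  proof (intro sum_mono powr_mono2)
    fix x assume "x \<in> B"
    then show "0 \<le> real (deg E u + deg E x) - 2"
      "real (deg E u + deg E x) - 2 \<le> real (deg E' u + deg E' x) - 2"
      using low[of x] le_u by (simp_all add: deg_eq)
  qed (use assms in simp)
  moreover have "sum (?q E v) A \<le> sum (?q E' u) A"
  proof (intro sum_mono powr_mono2)
    fix x assume "x \<in> A"
    then show "0 \<le> real (deg E v + deg E x) - 2"
      "real (deg E v + deg E x) - 2 \<le> real (deg E' u + deg E' x) - 2"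
      using low'[of x] le_v by (simp_all add: deg_eq)
  qed (use assms in simp)
  moreover have "sum (?q E u) C + sum (?q E v) C \<le> sum (?q E' u) C + sum (?q E' v) C"
    unfolding sum.distrib[symmetric]
  proof (intro sum_mono powr_spread assms)
    fix x assume x: "x \<in> C"
    \<comment> \<open>A common neighbour keeps \<open>v\<close> from becoming isolated by the
      shift.\<close>
    then have "C \<noteq> {}" by auto
    then have "card C \<ge> 1" using fin by (simp add: Suc_le_eq card_gt_0_iff)
    then have "deg E' v \<ge> 1" using d by linarith
    with x low[of x] show "0 \<le> real (deg E' v + deg E' x) - 2" by (simp add: deg_eq)
    show "real (deg E u + deg E x) - 2 + (real (deg E v + deg E x) - 2) =
        real (deg E' u + deg E' x) - 2 + (real (deg E' v + deg E' x) - 2)"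
      using bal x by (simp add: deg_eq)
  qed (use le_u le_v in \<open>auto simp: deg_eq\<close>)
  ultimately show ?thesis
    unfolding platt_split[OF G uv] E'_def[symmetric]
      platt_split[OF simple_shift[folded E'_def] uv]
    unfolding R Rsum nu nv nu' nv'
    using fin disj by (simp add: sum.union_disjoint Int_Un_distrib2)
qed

text \<open>With private sets of sizes \<open>a\<close> and \<open>b\<close> the sum grows by
  exactly \<open>2 * a * b\<close>. This supplies the strict progress that the weak inequality for
  the index does not give.\<close>

lemma sum_deg_sq_shift:
  assumes "priv E v u \<noteq> {}" "priv E u v \<noteq> {}" "v \<in> V"
  shows "(\<Sum>x\<in>V. (deg E x)\<^sup>2) < (\<Sum>x\<in>V. (deg (shift E u v) x)\<^sup>2)"
proof -
  define E' where "E' = shift E u v"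
  define a where "a = card (priv E v u)"
  define b where "b = card (priv E u v)"
  have fV: "finite V" using finite_verts[OF G] .
  have pos: "a > 0" "b > 0"
    using assms finite_nbrs[OF G] by (auto simp: a_def b_def priv_def card_gt_0_iff)
  have sq: "(\<Sum>x\<in>V. (deg F x)\<^sup>2) = (deg F u)\<^sup>2 + (deg F v)\<^sup>2 + (\<Sum>x\<in>V - {u, v}. (deg F x)\<^sup>2)" for F
    using fV uV assms(3) uv by (subst sum.subset_diff[of "{u, v}" V]) auto
  have "(\<Sum>x\<in>V - {u, v}. (deg E' x)\<^sup>2) = (\<Sum>x\<in>V - {u, v}. (deg E x)\<^sup>2)"
    by (intro sum.cong) (auto simp: E'_def deg_shift_other)
  moreover have "(deg E u)\<^sup>2 + (deg E v)\<^sup>2 < (deg E' u)\<^sup>2 + (deg E' v)\<^sup>2"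
    unfolding E'_def card_parts a_def[symmetric] b_def[symmetric]
    using pos by (simp add: power2_eq_square algebra_simps)
  ultimately show ?thesis
    unfolding sq E'_def[symmetric] by simp
qed

text \<open>A lost edge \<open>{v, z}\<close> is replaced by a walk from \<open>v\<close> to
  \<open>u\<close> followed by \<open>{u, z}\<close>. The walk uses the edge \<open>uv\<close> or a
  common neighbour, both of which survive the shift; with neither of them, \<open>v\<close> would
  lose all its neighbours.\<close>

lemma connected_shift:
  assumes conn: "connected_graph V E" and near: "{u, v} \<in> E \<or> nbrs E u \<inter> nbrs E v \<noteq> {}"
  shows "connected_graph V (shift E u v)"
proof -
  let ?E' = "shift E u v"
  have symE: "sym (adj_rel F)" for F :: "'a set set"
    by (auto simp: sym_def adj_rel_def insert_commute)
  have symc: "(x, y) \<in> (adj_rel F)\<^sup>* \<Longrightarrow> (y, x) \<in> (adj_rel F)\<^sup>*" for x y and F :: "'a set set"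
    using sym_rtrancl[OF symE] by (auto simp: sym_def)
  have adjI: "y \<in> nbrs F x \<Longrightarrow> (x, y) \<in> (adj_rel F)\<^sup>*" for x y and F :: "'a set set"
    by (auto simp: adj_rel_def nbrs_def)
  have vu: "(v, u) \<in> (adj_rel ?E')\<^sup>*"
    using near
  proof
    assume "{u, v} \<in> E"
    then have "u \<in> nbrs ?E' v"
      unfolding nbrs_shift_v by (auto simp: mem_nbrs priv_def insert_commute)
    then show ?thesis by (rule adjI)
  next
    assume "nbrs E u \<inter> nbrs E v \<noteq> {}"
    then obtain w where "w \<in> nbrs E u" "w \<in> nbrs E v" by auto
    then have "w \<in> nbrs ?E' u" "w \<in> nbrs ?E' v"
      unfolding nbrs_shift_v nbrs_shift_u by (auto simp: priv_def)
    then show ?thesis using symc adjI by (meson rtrancl_trans)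
  qed
  have step: "(x, y) \<in> (adj_rel ?E')\<^sup>*" if xy: "(x, y) \<in> adj_rel E" for x y
  proof (cases "{x, y} \<in> ?E'")
    case True
    then show ?thesis by (auto simp: adj_rel_def)
  next
    case False
    then obtain z where z: "z \<in> priv E v u" "{x, y} = {v, z}"
      using xy False by (auto simp: adj_rel_def shift_def)
    have "(u, z) \<in> (adj_rel ?E')\<^sup>*"
      using z(1) by (intro adjI) (simp add: nbrs_shift_u)
    with vu have "(v, z) \<in> (adj_rel ?E')\<^sup>*" by (rule rtrancl_trans)
    then show ?thesis using z(2) symc by (auto simp: doubleton_eq_iff)
  qed
  then have "(adj_rel E)\<^sup>* \<subseteq> (adj_rel ?E')\<^sup>*"
    by (metis rtrancl_idemp rtrancl_mono subrelI)
  then show ?thesis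
    using conn simple_shift by (auto simp: connected_graph_def)
qed

end

section \<open>Graphs with nested neighbourhoods\<close>

text \<open>Only pairs whose shift is known to preserve connectedness are constrained. The connected
  graphs of this kind are the connected threshold graphs.\<close>

definition nested :: "'a set \<Rightarrow> 'a set set \<Rightarrow> bool" where
  "nested V E \<longleftrightarrow> (\<forall>u\<in>V. \<forall>v\<in>V. u \<noteq> v \<longrightarrow> {u, v} \<in> E \<or> nbrs E u \<inter> nbrs E v \<noteq> {} \<longrightarrow>
     priv E u v = {} \<or> priv E v u = {})"

lemma nestedD:
  assumes "nested V E" "u \<in> V" "v \<in> V" "u \<noteq> v" "{u, v} \<in> E \<or> w \<in> nbrs E u \<inter> nbrs E v"
  shows "priv E u v = {} \<or> priv E v u = {}"
proof -
  have "{u, v} \<in> E \<or> nbrs E u \<inter> nbrs E v \<noteq> {}" using assms(5) by blast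
  then show ?thesis by (rule assms(1)[unfolded nested_def, rule_format, OF assms(2-4)])
qed

text \<open>Instead of iterating shifts, take a graph with the largest sum of squared degrees among
  the finitely many connected graphs on \<open>V\<close> with equally many edges and at least the
  same index. A pair violating nestedness would allow a shift to a larger sum within this
  family.\<close>

lemma exists_nested_graph:
  assumes conn: "connected_graph V E" and \<alpha>: "\<alpha> \<ge> 1"
  obtains E' where "connected_graph V E'" "card E' = card E" "platt \<alpha> E \<le> platt \<alpha> E'" "nested V E'"
proof -
  let ?P = "\<lambda>E'. connected_graph V E' \<and> card E' = card E \<and> platt \<alpha> E \<le> platt \<alpha> E'"
  let ?Q = "\<lambda>E'. \<Sum>x\<in>V. (deg E' x)\<^sup>2"
  have "finite V" using conn finite_verts by (auto simp: connected_graph_def)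
  moreover have "{E'. ?P E'} \<subseteq> Pow (Pow V)"
    using edges_subset_Pow by (fastforce simp: connected_graph_def)
  ultimately have "finite {E'. ?P E'}" by (meson finite_Pow_iff finite_subset)
  moreover have "E \<in> {E'. ?P E'}" using conn by simp
  ultimately obtain E' where E': "?P E'" and max: "\<And>F. ?P F \<Longrightarrow> ?Q F \<le> ?Q E'"
    using Max_in[of "?Q ` {E'. ?P E'}"] Max_ge[of "?Q ` {E'. ?P E'}"] by fastforce
  have G: "simple_graph V E'" using E' by (simp add: connected_graph_def)
  have "nested V E'"
    unfolding nested_def
  proof (intro ballI impI)
    fix u v
    assume uv: "u \<in> V" "v \<in> V" "u \<noteq> v" and near: "{u, v} \<in> E' \<or> nbrs E' u \<inter> nbrs E' v \<noteq> {}"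
    have "?P (shift E' u v)"
      using E' connected_shift[OF G uv(3,1) _ near] card_shift[OF G uv(3,1)]
        platt_shift[OF G uv(3,1) \<alpha>] by auto
    then have "\<not> ?Q E' < ?Q (shift E' u v)" using max by (simp add: not_less)
    then show "priv E' u v = {} \<or> priv E' v u = {}"
      using sum_deg_sq_shift[OF G uv(3,1)] uv(2) by blast
  qed
  then show ?thesis using E' that by blast
qed

context
  fixes V :: "'a set" and E :: "'a set set"
  assumes G: "simple_graph V E"
begin

text \<open>By \<open>card_parts\<close> the degrees of \<open>x\<close> and \<open>y\<close>
  compare as the sizes of their private sets do, so if one of these sets is empty, the one of the
  vertex of smaller degree is.\<close>

lemma priv_empty_of_deg_le:
  assumes "priv E x y = {} \<or> priv E y x = {}" "x \<noteq> y" "deg E x \<le> deg E y" "x \<in> V"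
  shows "priv E x y = {}"
proof -
  have fin: "finite (priv E x y)" using finite_nbrs[OF G] by (simp add: priv_def)
  have "card (priv E x y) \<le> card (priv E y x)"
    using card_parts[OF G assms(2,4)] assms(3) by simp
  then show ?thesis using assms(1) fin by auto
qed

text \<open>Take \<open>c\<close> of maximum degree. A neighbour of \<open>c\<close> has no private
  neighbours against \<open>c\<close>, so \<open>c\<close> together with its neighbours is closed
  under adjacency; by connectedness it is everything.\<close>

lemma nested_dominating:
  assumes conn: "connected_graph V E" and nest: "nested V E"
  obtains c where "c \<in> V" "V - {c} = nbrs E c"
proof -
  have "finite V" "V \<noteq> {}" using conn finite_verts[OF G] by (auto simp: connected_graph_def)
  then obtain c where c: "c \<in> V" and max: "\<And>x. x \<in> V \<Longrightarrow> deg E x \<le> deg E c"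
    using Max_in[of "deg E ` V"] Max_ge[of "deg E ` V"] by fastforce
  have closed: "y \<in> insert c (nbrs E c)" if "x \<in> insert c (nbrs E c)" "{x, y} \<in> E" for x y
  proof (cases "x = c")
    case False
    then have x: "{c, x} \<in> E" "x \<in> V" using that edge_verts[OF G] by (auto simp: mem_nbrs)
    then have "priv E x c = {} \<or> priv E c x = {}"
      using nestedD[OF nest x(2) c] False by (simp add: insert_commute)
    then have "priv E x c = {}" using False max x by (intro priv_empty_of_deg_le) auto
    then show ?thesis using that by (auto simp: priv_def mem_nbrs)
  qed (use that in \<open>auto simp: mem_nbrs\<close>)
  have "x \<in> insert c (nbrs E c)" if "(c, x) \<in> (adj_rel E)\<^sup>*" for x
    using that
  proof induction
    case (step y z)
    then show ?case using closed[of y z] by (simp add: adj_rel_def)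
  qed simp
  then have "V \<subseteq> insert c (nbrs E c)"
    using conn c by (auto simp: connected_graph_def)
  then show ?thesis using that c nbrs_subset[OF G] not_self_nbr[OF G] by blast
qed

end

text \<open>The star over an arbitrary vertex type, so that nested graphs and the concrete graphs
  built on \<open>star_E\<close> share the same formulas.\<close>

definition hub :: "'a \<Rightarrow> 'a set \<Rightarrow> 'a set set" where
  "hub c V = (\<lambda>x. {c, x}) ` (V - {c})"

lemma card_hub: "finite V \<Longrightarrow> c \<in> V \<Longrightarrow> card (hub c V) = card V - 1"
  unfolding hub_def by (subst card_image) (auto simp: inj_on_def doubleton_eq_iff)

definition pairs :: "'a set \<Rightarrow> 'a set set" where
  "pairs A = {B. B \<subseteq> A \<and> card B = 2}"

text \<open>Let \<open>w\<close> have maximum degree among the vertices other than the dominating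
  vertex \<open>c\<close>. Any further vertex \<open>x\<close> shares the neighbour \<open>c\<close>
  with \<open>w\<close>, so nestedness leaves \<open>x\<close> no private neighbours against
  \<open>w\<close>. Hence both ends of an edge avoiding \<open>c\<close> and \<open>w\<close> are
  neighbours of \<open>w\<close>.\<close>

lemma nested_structure:
  assumes conn: "connected_graph V E" and nest: "nested V E" and size: "card E + 1 = card V + k"
    and "k > 0"
  obtains c w A H where "finite V" "c \<in> V" "w \<in> V - {c}" "A \<subseteq> V - {c, w}" "H \<subseteq> pairs A"
    "E = hub c V \<union> ((\<lambda>x. {w, x}) ` A \<union> H)" "card A + card H = k"
proof -
  have G: "simple_graph V E" using conn by (simp add: connected_graph_def)
  have fV: "finite V" using finite_verts[OF G] .
  obtain c where c: "c \<in> V" "V - {c} = nbrs E c"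
    using nested_dominating[OF G conn nest] .
  have cE: "hub c V = {e \<in> E. c \<in> e}"
    unfolding hub_def c(2) edges_at[OF G] ..
  define H0 where "H0 = {e \<in> E. c \<notin> e}"
  have EH0: "E = hub c V \<union> H0" "hub c V \<inter> H0 = {}" unfolding cE H0_def by auto
  have fE: "finite E" using finite_edges[OF G] .
  have "card E = card (hub c V) + card H0"
    using EH0 fE by (metis card_Un_disjoint finite_Un)
  moreover have "card V \<ge> 1" using c fV by (simp add: Suc_le_eq card_gt_0_iff) blast
  ultimately have kH0: "card H0 = k" using size card_hub[OF fV c(1)] by simp
  \<comment> \<open>Since \<open>k > 0\<close> there is an edge avoiding \<open>c\<close>, and
    therefore a vertex from which \<open>w\<close> can be chosen.\<close>
  then have "H0 \<noteq> {}" using \<open>k > 0\<close> by auto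
  then obtain x y where "{x, y} \<in> H0" "x \<in> V"
    unfolding H0_def using edgeE[OF G] by blast
  then have "V - {c} \<noteq> {}" by (auto simp: H0_def)
  then obtain w where w: "w \<in> V - {c}" and max: "\<And>x. x \<in> V - {c} \<Longrightarrow> deg E x \<le> deg E w"
    using fV Max_in[of "deg E ` (V - {c})"] Max_ge[of "deg E ` (V - {c})"] by fastforce
  define A where "A = nbrs E w - {c}"
  define H where "H = {e \<in> H0. w \<notin> e}"
  have A: "A \<subseteq> V - {c, w}" using nbrs_subset[OF G] not_self_nbr[OF G] by (auto simp: A_def)
  have wA: "(\<lambda>x. {w, x}) ` A = {e \<in> H0. w \<in> e}"
    unfolding A_def H0_def using edges_at_avoiding[OF G, of c w] w by auto
  have priv: "priv E x w = {}" if "x \<in> V - {c, w}" for x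
  proof (rule priv_empty_of_deg_le[OF G])
    have "c \<in> nbrs E x \<inter> nbrs E w" using that w c(2) by (auto simp: nbrs_sym[of c])
    then show "priv E x w = {} \<or> priv E w x = {}"
      using nestedD[OF nest, of x w c] that w by blast
  qed (use that max in auto)
  have inA: "y \<in> A" if "{x, y} \<in> H" for x y
  proof -
    have "{x, y} \<in> E" "c \<notin> {x, y}" "w \<notin> {x, y}" using that by (auto simp: H_def H0_def)
    moreover have "y \<in> priv E x w \<or> y \<in> nbrs E w"
      using calculation by (auto simp: priv_def mem_nbrs)
    ultimately show ?thesis
      using priv[of x] edge_verts[OF G, of x y] by (auto simp: A_def)
  qed
  have "H \<subseteq> pairs A"
  proof
    fix e assume e: "e \<in> H"
    then have "e \<in> E" by (simp add: H_def H0_def)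
    then obtain x y where xy: "e = {x, y}" "x \<noteq> y" by (rule edgeE[OF G])
    then show "e \<in> pairs A" using inA[of x y] inA[of y x] e by (auto simp: pairs_def insert_commute)
  qed
  moreover have H0: "H0 = (\<lambda>x. {w, x}) ` A \<union> H" unfolding wA H_def by auto
  moreover have "card A + card H = k"
  proof -
    have "card ((\<lambda>x. {w, x}) ` A) = card A"
      by (intro card_image) (auto simp: inj_on_def doubleton_eq_iff)
    moreover have "card H0 = card ((\<lambda>x. {w, x}) ` A) + card H"
      unfolding wA using fE by (subst card_Un_disjoint[symmetric])
        (auto simp: H_def H0_def intro!: arg_cong[where f = card])
    ultimately show ?thesis using kH0 by simp
  qed
  ultimately show ?thesis using that[OF fV c(1) w A] EH0 by simp
qed

text \<open>The hub of the dominating vertex already has as many edges as the tree. The case is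
  separate because a one-vertex tree offers no vertex \<open>w\<close> for
  \<open>nested_structure\<close>.\<close>

lemma nested_tree:
  assumes conn: "connected_graph V E" and nest: "nested V E" and size: "card E + 1 = card V"
  obtains c where "finite V" "c \<in> V" "E = hub c V"
proof -
  have G: "simple_graph V E" using conn by (simp add: connected_graph_def)
  obtain c where c: "c \<in> V" "V - {c} = nbrs E c"
    using nested_dominating[OF G conn nest] .
  have "hub c V = {e \<in> E. c \<in> e}"
    unfolding hub_def c(2) edges_at[OF G] ..
  then have "hub c V \<subseteq> E" by auto
  moreover have "card (hub c V) = card E"
    using size card_hub[OF finite_verts[OF G] c(1)] by simp
  ultimately show ?thesis
    using that[OF finite_verts[OF G] c(1)] card_subset_eq[OF finite_edges[OF G]] by metis
qed

section \<open>The possible edges outside the hub when there are at most four\<close>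

lemma card_pairs: "finite A \<Longrightarrow> card (pairs A) = card A choose 2"
  unfolding pairs_def by (rule n_subsets)

lemma finite_pairs: "finite A \<Longrightarrow> finite (pairs A)"
  unfolding pairs_def by simp

lemma card_4_iff: "card A = 4 \<longleftrightarrow> (\<exists>w x y z. A = {w, x, y, z} \<and> distinct [w, x, y, z])"
proof
  assume "card A = 4"
  then have "card A = Suc 3" by simp
  then obtain w B where "A = insert w B" "w \<notin> B" "card B = 3"
    unfolding card_Suc_eq by blast
  then show "\<exists>w x y z. A = {w, x, y, z} \<and> distinct [w, x, y, z]"
    unfolding card_3_iff by auto
qed auto

text \<open>Since \<open>H\<close> has at most \<open>card A choose 2\<close> elements, the sizes of
  \<open>A\<close> and \<open>H\<close> can only be (1,0), (2,0), (3,0), (2,1), (4,0) or (3,1). When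
  \<open>H\<close> is a single pair, its ends are named first.\<close>

lemma core_cases:
  assumes "finite A" "H \<subseteq> pairs A"
  shows "card A + card H = 1 \<Longrightarrow> \<exists>a. A = {a} \<and> H = {}"
    and "card A + card H = 2 \<Longrightarrow> \<exists>a b. A = {a, b} \<and> a \<noteq> b \<and> H = {}"
    and "card A + card H = 3 \<Longrightarrow>
      (\<exists>a b d. A = {a, b, d} \<and> distinct [a, b, d] \<and> H = {}) \<or>
      (\<exists>a b. A = {a, b} \<and> a \<noteq> b \<and> H = {{a, b}})"
    and "card A + card H = 4 \<Longrightarrow>
      (\<exists>a b d f. A = {a, b, d, f} \<and> distinct [a, b, d, f] \<and> H = {}) \<or>
      (\<exists>a b d. A = {a, b, d} \<and> distinct [a, b, d] \<and> H = {{a, b}})"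
proof -
  have fH: "finite H" and le: "card H \<le> card A choose 2"
    using assms by (auto simp: card_pairs[symmetric] finite_pairs finite_subset intro: card_mono)
  have small: "card H = 0" if "card A \<le> 1"
    using that le by (simp add: binomial_eq_0)
  have single: "\<exists>a b. H = {{a, b}} \<and> a \<noteq> b \<and> a \<in> A \<and> b \<in> A" if "card H = 1"
  proof -
    obtain e where "H = {e}" using \<open>card H = 1\<close> by (auto simp: card_1_singleton_iff)
    then show ?thesis using assms(2) by (auto simp: pairs_def card_2_iff)
  qed
  {
    assume k: "card A + card H = 1"
    then have "card A = 1" "card H = 0" using small by linarith+
    then show "\<exists>a. A = {a} \<and> H = {}" using fH by (auto simp: card_1_singleton_iff)
  next
    assume k: "card A + card H = 2"
    then have "card A = 2" "card H = 0"
      using small le by (cases "card A \<le> 1"; simp)+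
    then show "\<exists>a b. A = {a, b} \<and> a \<noteq> b \<and> H = {}" using fH by (auto simp: card_2_iff)
  next
    assume k: "card A + card H = 3"
    then have "card A > 1" using small by linarith
    then consider "card A = 3" "card H = 0" | "card A = 2" "card H = 1" using k by linarith
    then show "(\<exists>a b d. A = {a, b, d} \<and> distinct [a, b, d] \<and> H = {}) \<or>
      (\<exists>a b. A = {a, b} \<and> a \<noteq> b \<and> H = {{a, b}})"
    proof cases
      case 1
      then show ?thesis using fH by (auto simp: card_3_iff)
    next
      case 2
      then obtain a b where "H = {{a, b}}" "a \<noteq> b" "a \<in> A" "b \<in> A" using single by auto
      moreover have "{a, b} = A"
        using calculation 2 assms(1) by (intro card_subset_eq) auto
      ultimately show ?thesis by auto
    qed
  next
    assume k: "card A + card H = 4"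
    then have "card A > 1" "card A \<noteq> 2" using small le by (force, auto)
    then consider "card A = 4" "card H = 0" | "card A = 3" "card H = 1" using k by linarith
    then show "(\<exists>a b d f. A = {a, b, d, f} \<and> distinct [a, b, d, f] \<and> H = {}) \<or>
      (\<exists>a b d. A = {a, b, d} \<and> distinct [a, b, d] \<and> H = {{a, b}})"
    proof cases
      case 1
      then show ?thesis using fH by (auto simp: card_4_iff)
    next
      case 2
      then obtain a b where ab: "H = {{a, b}}" "a \<noteq> b" "a \<in> A" "b \<in> A" using single by auto
      then have "card (A - {a, b}) = 1" using 2 assms(1) by (simp add: card_Diff_subset)
      then obtain d where "A - {a, b} = {d}" by (auto simp: card_1_singleton_iff)
      then have "A = {a, b, d}" "distinct [a, b, d]" using ab by auto
      then show ?thesis using ab by blast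
    qed
  }
qed

section \<open>The index of a star with additional edges\<close>

lemma deg_empty [simp]: "deg {} x = 0"
  by (simp add: deg_def)

lemma deg_insert:
  assumes "finite H" "e \<notin> H"
  shows "deg (insert e H) x = deg H x + of_bool (x \<in> e)"
proof -
  have "{f \<in> insert e H. x \<in> f} = (if x \<in> e then insert e {f \<in> H. x \<in> f} else {f \<in> H. x \<in> f})"
    by auto
  then show ?thesis using assms by (simp add: deg_def)
qed

context
  fixes V :: "'a set" and H :: "'a set set" and c :: 'a
  assumes fV: "finite V" and c: "c \<in> V" and H: "simple_graph (V - {c}) H"
begin

lemma center_notin: "e \<in> H \<Longrightarrow> c \<notin> e"
  using edges_subset_Pow[OF H] by blast

lemma hub_disjoint: "hub c V \<inter> H = {}"
  using center_notin by (auto simp: hub_def)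

lemma simple_hub: "simple_graph V (hub c V \<union> H)"
  unfolding simple_graph_def
proof (intro conjI ballI fV)
  fix e assume "e \<in> hub c V \<union> H"
  then show "\<exists>u v. e = {u, v} \<and> u \<noteq> v \<and> u \<in> V \<and> v \<in> V"
  proof
    assume "e \<in> H"
    then show ?thesis using edgeE[OF H, of e] by (metis Diff_iff)
  qed (use c in \<open>auto simp: hub_def\<close>)
qed

lemma cyclic_class_hub: "cyclic_class (card H) (card V) V (hub c V \<union> H)"
proof -
  have "(c, x) \<in> (adj_rel (hub c V \<union> H))\<^sup>* \<and> (x, c) \<in> (adj_rel (hub c V \<union> H))\<^sup>*" if "x \<in> V" for x
  proof (cases "x = c")
    case False
    then have "{c, x} \<in> hub c V" using that by (auto simp: hub_def)
    then have "(c, x) \<in> adj_rel (hub c V \<union> H)" "(x, c) \<in> adj_rel (hub c V \<union> H)"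
      by (auto simp: adj_rel_def insert_commute)
    then show ?thesis by blast
  qed simp
  then have "connected_graph V (hub c V \<union> H)"
    unfolding connected_graph_def using simple_hub c by (meson empty_iff rtrancl_trans)
  moreover have "card (hub c V \<union> H) + 1 = card V + card H"
  proof -
    have "card V > 0" using fV c card_gt_0_iff by blast
    moreover have "finite (hub c V)" using fV by (simp add: hub_def)
    ultimately show ?thesis
      using card_hub[OF fV c] finite_edges[OF H] hub_disjoint by (simp add: card_Un_disjoint)
  qed
  ultimately show ?thesis by (simp add: cyclic_class_def)
qed

lemma deg_hub_center: "deg (hub c V \<union> H) c = card V - 1"
proof -
  have "{e \<in> hub c V \<union> H. c \<in> e} = hub c V"
    using center_notin by (auto simp: hub_def)
  then show ?thesis by (simp add: deg_def card_hub[OF fV c])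
qed

lemma deg_hub_leaf:
  assumes "x \<in> V - {c}"
  shows "deg (hub c V \<union> H) x = Suc (deg H x)"
proof -
  have "{e \<in> hub c V \<union> H. x \<in> e} = insert {c, x} {e \<in> H. x \<in> e}"
    using assms by (auto simp: hub_def)
  moreover have "{c, x} \<notin> H" using center_notin by blast
  ultimately show ?thesis using finite_edges[OF H] by (simp add: deg_def)
qed

text \<open>The centre has degree \<open>card V - 1\<close> and a leaf \<open>x\<close> has degree
  \<open>1 + deg H x\<close>, so the hub edge at \<open>x\<close> has base
  \<open>N + deg H x\<close>. On an edge of \<open>H\<close> the two hub edges at its ends cancel
  the subtracted 2. \<open>U\<close> collects the leaves that \<open>H\<close> may touch; every
  other leaf contributes \<open>N powr \<alpha>\<close>.\<close>

lemma platt_hub: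
  assumes U: "U \<subseteq> V - {c}" "\<Union> H \<subseteq> U"
  defines "N \<equiv> real (card V) - 2"
  shows "platt \<alpha> (hub c V \<union> H) = (real (card V) - 1 - real (card U)) * N powr \<alpha>
    + (\<Sum>x\<in>U. (N + real (deg H x)) powr \<alpha>)
    + (\<Sum>e\<in>H. real (\<Sum>x\<in>e. deg H x) powr \<alpha>)"
proof -
  let ?E = "hub c V \<union> H"
  let ?p = "\<lambda>e. (real (\<Sum>x\<in>e. deg ?E x) - 2) powr \<alpha>"
  have n: "card V > 0" using fV c card_gt_0_iff by blast
  have fU: "finite U" using U fV finite_subset by blast
  have zero: "deg H x = 0" if "x \<notin> U" for x
  proof -
    have "{e \<in> H. x \<in> e} = {}" using that U by auto
    then show ?thesis unfolding deg_def by (simp only: card.empty)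
  qed
  have "sum ?p (hub c V) = (\<Sum>x\<in>V - {c}. ?p {c, x})"
    unfolding hub_def by (subst sum.reindex) (auto simp: inj_on_def doubleton_eq_iff)
  also have "\<dots> = (\<Sum>x\<in>V - {c}. (N + real (deg H x)) powr \<alpha>)"
  proof (rule sum.cong[OF refl])
    fix x assume x: "x \<in> V - {c}"
    then have "real (\<Sum>z\<in>{c, x}. deg ?E z) - 2 = N + real (deg H x)"
      using n x deg_hub_center deg_hub_leaf[OF x] by (auto simp: N_def of_nat_diff)
    then show "?p {c, x} = (N + real (deg H x)) powr \<alpha>" by simp
  qed
  also have "\<dots> = (\<Sum>x\<in>V - {c} - U. (N + real (deg H x)) powr \<alpha>)
    + (\<Sum>x\<in>U. (N + real (deg H x)) powr \<alpha>)"
    using U fV by (intro sum.subset_diff) auto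
  also have "(\<Sum>x\<in>V - {c} - U. (N + real (deg H x)) powr \<alpha>) = (\<Sum>x\<in>V - {c} - U. N powr \<alpha>)"
    by (intro sum.cong) (auto simp: zero)
  also have "\<dots> = real (card (V - {c} - U)) * N powr \<alpha>" by simp
  also have "real (card (V - {c} - U)) = real (card V) - 1 - real (card U)"
  proof -
    have "card U \<le> card (V - {c})" using U fV by (intro card_mono) auto
    then show ?thesis using U fU fV c n by (simp add: card_Diff_subset of_nat_diff)
  qed
  finally have 1: "sum ?p (hub c V) = (real (card V) - 1 - real (card U)) * N powr \<alpha>
    + (\<Sum>x\<in>U. (N + real (deg H x)) powr \<alpha>)" .
  have 2: "sum ?p H = (\<Sum>e\<in>H. real (\<Sum>x\<in>e. deg H x) powr \<alpha>)"
  proof (rule sum.cong[OF refl])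
    fix e assume "e \<in> H"
    then obtain x y where "e = {x, y}" "x \<noteq> y" "x \<in> V - {c}" "y \<in> V - {c}" by (rule edgeE[OF H])
    then show "?p e = real (\<Sum>x\<in>e. deg H x) powr \<alpha>" by (simp add: deg_hub_leaf)
  qed
  have "platt \<alpha> ?E = sum ?p (hub c V) + sum ?p H"
    unfolding platt_def using hub_disjoint finite_edges[OF H] fV
    by (intro sum.union_disjoint) (auto simp: hub_def)
  then show ?thesis unfolding 1 2 .
qed

end

lemma simple_graph_doubletons:
  "finite W \<Longrightarrow> simple_graph W {}"
  "simple_graph W (insert {x, y} H) \<longleftrightarrow> simple_graph W H \<and> x \<noteq> y \<and> x \<in> W \<and> y \<in> W"
  by (auto simp: simple_graph_def doubleton_eq_iff)

section \<open>Closed formulas for the seven candidate graphs\<close>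

context
  fixes V :: "'a set" and c :: 'a and N :: real
  assumes fV: "finite V" and c: "c \<in> V"
  defines "N \<equiv> real (card V) - 2"
begin

lemma platt_star: "platt \<alpha> (hub c V) = (real (card V) - 1) * N powr \<alpha>"
  using platt_hub[OF fV c, of "{}" "{}" \<alpha>] fV by (simp add: simple_graph_doubletons N_def)

lemma platt_Splus:
  assumes "{w, x} \<subseteq> V - {c}" "distinct [w, x]"
  shows "platt \<alpha> (hub c V \<union> {{w, x}}) =
    (real (card V) - 3) * N powr \<alpha> + 2 * (N + 1) powr \<alpha> + 2 powr \<alpha>"
  using platt_hub[OF fV c, of "{{w, x}}" "{w, x}" \<alpha>] assms fV
  by (simp add: simple_graph_doubletons N_def deg_insert doubleton_eq_iff)

lemma platt_B1:
  assumes "{w, x, y} \<subseteq> V - {c}" "distinct [w, x, y]"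
  shows "platt \<alpha> (hub c V \<union> {{w, x}, {w, y}}) =
    (real (card V) - 4) * N powr \<alpha> + 2 * (N + 1) powr \<alpha> + (N + 2) powr \<alpha> + 2 * 3 powr \<alpha>"
proof -
  define H where "H = {{w, x}, {w, y}}"
  have ne: "{w, x} \<noteq> {w, y}"
    using assms(2) by (simp_all add: doubleton_eq_iff)
  have "deg H v = of_bool (v \<in> {w, x}) + of_bool (v \<in> {w, y})" for v
    unfolding H_def using ne by (simp add: deg_insert)
  then have deg: "deg H w = 2" "deg H x = 1" "deg H y = 1"
    using assms(2) by auto
  have sumH: "sum g H = g {w, x} + g {w, y}" for g :: "'a set \<Rightarrow> real"
    unfolding H_def using ne by simp
  have H: "simple_graph (V - {c}) H"
    unfolding H_def using assms fV by (simp add: simple_graph_doubletons)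
  have "\<Union> H = {w, x, y}" by (auto simp: H_def)
  with platt_hub[OF fV c H, of "{w, x, y}" \<alpha>] show ?thesis
    unfolding H_def[symmetric] using assms by (simp add: N_def deg sumH)
qed

lemma platt_G4:
  assumes "{w, x, y, z} \<subseteq> V - {c}" "distinct [w, x, y, z]"
  shows "platt \<alpha> (hub c V \<union> {{w, x}, {w, y}, {w, z}}) =
    (real (card V) - 5) * N powr \<alpha> + 3 * (N + 1) powr \<alpha> + (N + 3) powr \<alpha> + 3 * 4 powr \<alpha>"
proof -
  define H where "H = {{w, x}, {w, y}, {w, z}}"
  have ne: "{w, x} \<noteq> {w, y}" "{w, x} \<noteq> {w, z}" "{w, y} \<noteq> {w, z}"
    using assms(2) by (simp_all add: doubleton_eq_iff)
  have "deg H v = of_bool (v \<in> {w, x}) + of_bool (v \<in> {w, y}) + of_bool (v \<in> {w, z})" for v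
    unfolding H_def using ne by (simp add: deg_insert)
  then have deg: "deg H w = 3" "deg H x = 1" "deg H y = 1" "deg H z = 1"
    using assms(2) by auto
  have sumH: "sum g H = g {w, x} + g {w, y} + g {w, z}" for g :: "'a set \<Rightarrow> real"
    unfolding H_def using ne by simp
  have H: "simple_graph (V - {c}) H"
    unfolding H_def using assms fV by (simp add: simple_graph_doubletons)
  have "\<Union> H = {w, x, y, z}" by (auto simp: H_def)
  with platt_hub[OF fV c H, of "{w, x, y, z}" \<alpha>] show ?thesis
    unfolding H_def[symmetric] using assms by (simp add: N_def deg sumH)
qed

lemma platt_G5:
  assumes "{w, x, y} \<subseteq> V - {c}" "distinct [w, x, y]"
  shows "platt \<alpha> (hub c V \<union> {{w, x}, {w, y}, {x, y}}) =
    (real (card V) - 4) * N powr \<alpha> + 3 * (N + 2) powr \<alpha> + 3 * 4 powr \<alpha>"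
proof -
  define H where "H = {{w, x}, {w, y}, {x, y}}"
  have ne: "{w, x} \<noteq> {w, y}" "{w, x} \<noteq> {x, y}" "{w, y} \<noteq> {x, y}"
    using assms(2) by (simp_all add: doubleton_eq_iff)
  have "deg H v = of_bool (v \<in> {w, x}) + of_bool (v \<in> {w, y}) + of_bool (v \<in> {x, y})" for v
    unfolding H_def using ne by (simp add: deg_insert)
  then have deg: "deg H w = 2" "deg H x = 2" "deg H y = 2"
    using assms(2) by auto
  have sumH: "sum g H = g {w, x} + g {w, y} + g {x, y}" for g :: "'a set \<Rightarrow> real"
    unfolding H_def using ne by simp
  have H: "simple_graph (V - {c}) H"
    unfolding H_def using assms fV by (simp add: simple_graph_doubletons)
  have "\<Union> H = {w, x, y}" by (auto simp: H_def)
  with platt_hub[OF fV c H, of "{w, x, y}" \<alpha>] show ?thesis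
    unfolding H_def[symmetric] using assms by (simp add: N_def deg sumH)
qed

lemma platt_H4:
  assumes "{w, x, y, z, t} \<subseteq> V - {c}" "distinct [w, x, y, z, t]"
  shows "platt \<alpha> (hub c V \<union> {{w, x}, {w, y}, {w, z}, {w, t}}) =
    (real (card V) - 6) * N powr \<alpha> + 4 * (N + 1) powr \<alpha> + (N + 4) powr \<alpha> + 4 * 5 powr \<alpha>"
proof -
  define H where "H = {{w, x}, {w, y}, {w, z}, {w, t}}"
  have ne: "{w, x} \<noteq> {w, y}" "{w, x} \<noteq> {w, z}" "{w, x} \<noteq> {w, t}"
    "{w, y} \<noteq> {w, z}" "{w, y} \<noteq> {w, t}" "{w, z} \<noteq> {w, t}"
    using assms(2) by (simp_all add: doubleton_eq_iff)
  have "deg H v = of_bool (v \<in> {w, x}) + of_bool (v \<in> {w, y}) + of_bool (v \<in> {w, z})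
    + of_bool (v \<in> {w, t})" for v
    unfolding H_def using ne by (simp add: deg_insert)
  then have deg: "deg H w = 4" "deg H x = 1" "deg H y = 1" "deg H z = 1" "deg H t = 1"
    using assms(2) by auto
  have sumH: "sum g H = g {w, x} + g {w, y} + g {w, z} + g {w, t}" for g :: "'a set \<Rightarrow> real"
    unfolding H_def using ne by simp
  have H: "simple_graph (V - {c}) H"
    unfolding H_def using assms fV by (simp add: simple_graph_doubletons)
  have "\<Union> H = {w, x, y, z, t}" by (auto simp: H_def)
  with platt_hub[OF fV c H, of "{w, x, y, z, t}" \<alpha>] show ?thesis
    unfolding H_def[symmetric] using assms by (simp add: N_def deg sumH)
qed

lemma platt_H5:
  assumes "{w, x, y, z} \<subseteq> V - {c}" "distinct [w, x, y, z]"
  shows "platt \<alpha> (hub c V \<union> {{w, x}, {w, y}, {w, z}, {x, y}}) =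
    (real (card V) - 5) * N powr \<alpha> + (N + 1) powr \<alpha> + 2 * (N + 2) powr \<alpha> + (N + 3) powr \<alpha>
    + 2 * 5 powr \<alpha> + 2 * 4 powr \<alpha>"
proof -
  define H where "H = {{w, x}, {w, y}, {w, z}, {x, y}}"
  have ne: "{w, x} \<noteq> {w, y}" "{w, x} \<noteq> {w, z}" "{w, x} \<noteq> {x, y}"
    "{w, y} \<noteq> {w, z}" "{w, y} \<noteq> {x, y}" "{w, z} \<noteq> {x, y}"
    using assms(2) by (simp_all add: doubleton_eq_iff)
  have "deg H v = of_bool (v \<in> {w, x}) + of_bool (v \<in> {w, y}) + of_bool (v \<in> {w, z})
    + of_bool (v \<in> {x, y})" for v
    unfolding H_def using ne by (simp add: deg_insert)
  then have deg: "deg H w = 3" "deg H x = 2" "deg H y = 2" "deg H z = 1"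
    using assms(2) by auto
  have sumH: "sum g H = g {w, x} + g {w, y} + g {w, z} + g {x, y}" for g :: "'a set \<Rightarrow> real"
    unfolding H_def using ne by simp
  have H: "simple_graph (V - {c}) H"
    unfolding H_def using assms fV by (simp add: simple_graph_doubletons)
  have "\<Union> H = {w, x, y, z}" by (auto simp: H_def)
  with platt_hub[OF fV c H, of "{w, x, y, z}" \<alpha>] show ?thesis
    unfolding H_def[symmetric] using assms by (simp add: N_def deg sumH)
qed

end

section \<open>Finite differences of \<open>x powr \<alpha>\<close>\<close>

text \<open>The mean value theorem on the two adjacent unit intervals turns \<open>D\<close> into
  \<open>\<beta>\<close> times an increment of \<open>x powr (\<beta> - 1)\<close>, a function that
  increases for \<open>\<beta> > 1\<close> and decreases for \<open>\<beta> < 1\<close>.\<close>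

lemma powr_second_diff:
  fixes t \<beta> :: real
  assumes "t > 0"
  defines "D \<equiv> (t + 2) powr \<beta> - 2 * (t + 1) powr \<beta> + t powr \<beta>"
  shows "\<beta> > 1 \<Longrightarrow> D > 0" "0 < \<beta> \<Longrightarrow> \<beta> < 1 \<Longrightarrow> D < 0"
proof -
  have der: "((\<lambda>x. x powr \<beta>) has_real_derivative \<beta> * x powr (\<beta> - 1)) (at x)" if "x > 0" for x
    using that by (rule has_real_derivative_powr)
  have "\<exists>z>s. z < s + 1 \<and> (s + 1) powr \<beta> - s powr \<beta> = \<beta> * z powr (\<beta> - 1)" if "s > 0" for s
    using MVT2[of s "s + 1" "\<lambda>x. x powr \<beta>" "\<lambda>x. \<beta> * x powr (\<beta> - 1)"] der that by auto
  from this[of t] this[of "t + 1"] assms(1) obtain y z where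
    y: "t < y" "y < t + 1" "(t + 1) powr \<beta> - t powr \<beta> = \<beta> * y powr (\<beta> - 1)" and
    z: "t + 1 < z" "(t + 2) powr \<beta> - (t + 1) powr \<beta> = \<beta> * z powr (\<beta> - 1)"
    by (auto simp: algebra_simps)
  have D: "D = \<beta> * (z powr (\<beta> - 1) - y powr (\<beta> - 1))"
    using y(3) z(2) by (simp add: D_def algebra_simps)
  show "D > 0" if "\<beta> > 1"
    unfolding D using that y z assms(1) by (intro mult_pos_pos) (auto intro: powr_less_mono2)
  show "D < 0" if "0 < \<beta>" "\<beta> < 1"
    unfolding D using that y z assms(1)
    by (intro mult_pos_neg) (auto intro: powr_less_mono2_neg)
qed

text \<open>The derivative of \<open>D\<close> is \<open>\<alpha>\<close> times the second
  difference for the exponent \<open>\<alpha> - 1\<close>, whose sign changes at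
  \<open>\<alpha> = 2\<close> by \<open>powr_second_diff\<close>.\<close>

lemma powr_second_diff_mono:
  fixes s t \<alpha> :: real
  assumes st: "0 < s" "s < t"
  defines "D \<equiv> \<lambda>t. (t + 2) powr \<alpha> - 2 * (t + 1) powr \<alpha> + t powr \<alpha>"
  shows "\<alpha> > 2 \<Longrightarrow> D s < D t" "1 < \<alpha> \<Longrightarrow> \<alpha> < 2 \<Longrightarrow> D t < D s"
proof -
  let ?D' = "\<lambda>x. \<alpha> * ((x + 2) powr (\<alpha> - 1) - 2 * (x + 1) powr (\<alpha> - 1) + x powr (\<alpha> - 1))"
  have der: "(D has_real_derivative ?D' x) (at x)" if "x > 0" for x
    unfolding D_def using that by (auto intro!: derivative_eq_intros simp: algebra_simps)
  obtain z where z: "s < z" "D t - D s = (t - s) * ?D' z"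
    using MVT2[OF st(2), of D ?D'] der st by auto
  show "D s < D t" if "\<alpha> > 2"
  proof -
    have "?D' z > 0" using powr_second_diff(1)[of z "\<alpha> - 1"] that z(1) st by simp
    then have "(t - s) * ?D' z > 0" using st by (simp add: mult_pos_pos)
    then show ?thesis using z(2) by linarith
  qed
  show "D t < D s" if "1 < \<alpha>" "\<alpha> < 2"
  proof -
    have "?D' z < 0" using powr_second_diff(2)[of z "\<alpha> - 1"] that z(1) st
      by (intro mult_pos_neg) auto
    then have "(t - s) * ?D' z < 0" using st by (simp add: mult_pos_neg)
    then show ?thesis using z(2) by linarith
  qed
qed

text \<open>\<open>T\<close> is the third forward difference, that is, the increment of the second
  difference from \<open>t\<close> to \<open>t + 1\<close>. It vanishes for polynomials of degree at
  most 2, hence the exponents 1 and 2.\<close>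

lemma powr_third_diff:
  fixes t \<alpha> :: real
  assumes "t > 0"
  defines "T \<equiv> (t + 3) powr \<alpha> + 3 * (t + 1) powr \<alpha> - (3 * (t + 2) powr \<alpha> + t powr \<alpha>)"
  shows "\<alpha> > 2 \<Longrightarrow> T > 0" "1 < \<alpha> \<Longrightarrow> \<alpha> < 2 \<Longrightarrow> T < 0" "\<alpha> = 1 \<or> \<alpha> = 2 \<Longrightarrow> T = 0"
proof -
  have shift: "t + 1 + 2 = t + 3" "t + 1 + 1 = t + 2" by auto
  show "\<alpha> > 2 \<Longrightarrow> T > 0" "1 < \<alpha> \<Longrightarrow> \<alpha> < 2 \<Longrightarrow> T < 0"
    using powr_second_diff_mono[of t "t + 1" \<alpha>, unfolded shift] assms(1) unfolding T_def by argo+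
  show "T = 0" if "\<alpha> = 1 \<or> \<alpha> = 2"
    using that assms(1) by (auto simp: T_def power2_eq_square algebra_simps)
qed

text \<open>This is the comparison of \<open>H5_E\<close> with \<open>H4_E\<close> after
  cancellation, for \<open>N = n - 2\<close>. In terms of the second difference the right side
  exceeds the left by \<open>D (N + 2) + D (N + 1) - D N + 2 * (5 powr \<alpha> - 4 powr
  \<alpha>)\<close>. If \<open>D\<close> does not decrease, \<open>D (N + 1)\<close> outweighs
  \<open>D N\<close>; for \<open>1 < \<alpha> < 2\<close> the last term does.\<close>

lemma powr_H5_le_H4:
  fixes N \<alpha> :: real
  assumes N: "N \<ge> 4" and \<alpha>: "\<alpha> \<ge> 1"
  shows "N powr \<alpha> + (N + 3) powr \<alpha> + 2 * (N + 2) powr \<alpha> + 2 * 4 powr \<alpha>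
    \<le> (N + 4) powr \<alpha> + 3 * (N + 1) powr \<alpha> + 2 * 5 powr \<alpha>"
proof -
  define D where "D t = (t + 2) powr \<alpha> - 2 * (t + 1) powr \<alpha> + t powr \<alpha>" for t :: real
  have nonneg: "D t \<ge> 0" if "t > 0" for t
  proof (cases "\<alpha> = 1")
    case False
    then show ?thesis using powr_second_diff(1)[of t \<alpha>] that \<alpha> by (simp add: D_def)
  qed (use that in \<open>simp add: D_def\<close>)
  have mono: "3 powr \<alpha> \<le> (4::real) powr \<alpha>" "4 powr \<alpha> \<le> (5::real) powr \<alpha>"
    using \<alpha> by (auto intro!: powr_mono2)
  have "D N \<le> D (N + 2) + D (N + 1) + 2 * (5 powr \<alpha> - 4 powr \<alpha>)"
  proof (cases "1 < \<alpha> \<and> \<alpha> < 2")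
    case True
    \<comment> \<open>\<open>D\<close> is decreasing here, and 3 is the point where it consists of
      powers of 5, 4 and 3, so that it is at most
      \<open>5 powr \<alpha> - 4 powr \<alpha>\<close>.\<close>
    then have "D N \<le> D 3"
      using powr_second_diff_mono(2)[of 3 N \<alpha>] N by (simp add: D_def)
    also have "\<dots> = 5 powr \<alpha> - 2 * 4 powr \<alpha> + 3 powr \<alpha>" by (simp add: D_def)
    finally show ?thesis using mono nonneg[of "N + 1"] nonneg[of "N + 2"] N by argo
  next
    case False
    then consider "\<alpha> = 1 \<or> \<alpha> = 2" | "\<alpha> > 2" using \<alpha> by linarith
    then have "D N \<le> D (N + 1)"
    proof cases
      case 1
      then show ?thesis using N by (auto simp: D_def power2_eq_square algebra_simps)
    next
      case 2
      then show ?thesis using powr_second_diff_mono(1)[of N "N + 1" \<alpha>] N by (simp add: D_def)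
    qed
    then show ?thesis using mono nonneg[of "N + 2"] N by argo
  qed
  moreover have "N + 2 + 2 = N + 4" "N + 2 + 1 = N + 3" "N + 1 + 2 = N + 3" "N + 1 + 1 = N + 2" by auto
  ultimately show ?thesis unfolding D_def by simp
qed

section \<open>Extremal graphs\<close>

lemma cyclic_class_le_hub:
  assumes "cyclic_class k n V E" "\<alpha> \<ge> 1" "k > 0"
  obtains c w A H where "finite V" "card V = n" "c \<in> V" "w \<in> V - {c}" "A \<subseteq> V - {c, w}"
    "H \<subseteq> pairs A" "card A + card H = k"
    "platt \<alpha> E \<le> platt \<alpha> (hub c V \<union> ((\<lambda>x. {w, x}) ` A \<union> H))"
proof -
  have E: "connected_graph V E" "card V = n" "card E + 1 = n + k"
    using assms(1) by (auto simp: cyclic_class_def)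
  obtain E' where E': "connected_graph V E'" "card E' = card E" "platt \<alpha> E \<le> platt \<alpha> E'" "nested V E'"
    using exists_nested_graph[OF E(1) assms(2)] .
  have "card E' + 1 = card V + k" using E E' by simp
  from nested_structure[OF E'(1,4) this assms(3)] that E(2) E'(3) show ?thesis by metis
qed

context
  fixes \<alpha> :: real and n :: nat and V :: "'a set" and E :: "'a set set" and N :: real
  assumes \<alpha>: "\<alpha> \<ge> 1"
  defines "N \<equiv> real n - 2"
begin

lemma platt_tree_le:
  assumes "is_tree n V E"
  shows "platt \<alpha> E \<le> (real n - 1) * N powr \<alpha>"
proof -
  have E: "connected_graph V E" "card V = n" "card E + 1 = n"
    using assms by (auto simp: cyclic_class_def)
  obtain E' where E': "connected_graph V E'" "card E' = card E" "platt \<alpha> E \<le> platt \<alpha> E'" "nested V E'"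
    using exists_nested_graph[OF E(1) \<alpha>] .
  have "card E' + 1 = card V" using E E' by simp
  from nested_tree[OF E'(1,4) this] obtain c where "finite V" "c \<in> V" "E' = hub c V" .
  then show ?thesis using E'(3) E(2) platt_star[of V c \<alpha>] by (simp add: N_def)
qed

lemma platt_unicyclic_le:
  assumes "is_unicyclic n V E"
  shows "platt \<alpha> E \<le> (real n - 3) * N powr \<alpha> + 2 * (N + 1) powr \<alpha> + 2 powr \<alpha>"
proof -
  obtain c w A H where s: "finite V" "card V = n" "c \<in> V" "w \<in> V - {c}" "A \<subseteq> V - {c, w}"
    "H \<subseteq> pairs A" "card A + card H = 1"
    "platt \<alpha> E \<le> platt \<alpha> (hub c V \<union> ((\<lambda>x. {w, x}) ` A \<union> H))"
    using cyclic_class_le_hub[OF assms \<alpha> zero_less_one] .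
  have "finite A" using s finite_subset by blast
  then obtain x where x: "A = {x}" "H = {}" using core_cases(1)[OF _ s(6,7)] by auto
  then have "{w, x} \<subseteq> V - {c}" "distinct [w, x]" using s by auto
  from platt_Splus[OF s(1,3) this, of \<alpha>] s x show ?thesis by (simp add: N_def)
qed

lemma platt_bicyclic_le:
  assumes "is_bicyclic n V E"
  shows "platt \<alpha> E \<le> (real n - 4) * N powr \<alpha> + 2 * (N + 1) powr \<alpha> + (N + 2) powr \<alpha> + 2 * 3 powr \<alpha>"
proof -
  obtain c w A H where s: "finite V" "card V = n" "c \<in> V" "w \<in> V - {c}" "A \<subseteq> V - {c, w}"
    "H \<subseteq> pairs A" "card A + card H = 2"
    "platt \<alpha> E \<le> platt \<alpha> (hub c V \<union> ((\<lambda>x. {w, x}) ` A \<union> H))"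
    by (rule cyclic_class_le_hub[OF assms \<alpha>]) auto
  have "finite A" using s finite_subset by blast
  then obtain x y where x: "A = {x, y}" "x \<noteq> y" "H = {}" using core_cases(2)[OF _ s(6,7)] by auto
  then have "{w, x, y} \<subseteq> V - {c}" "distinct [w, x, y]" using s by auto
  from platt_B1[OF s(1,3) this, of \<alpha>] s x show ?thesis by (simp add: N_def)
qed

lemma platt_tricyclic_le:
  assumes "is_tricyclic n V E"
  shows "platt \<alpha> E \<le> max
    ((real n - 5) * N powr \<alpha> + 3 * (N + 1) powr \<alpha> + (N + 3) powr \<alpha> + 3 * 4 powr \<alpha>)
    ((real n - 4) * N powr \<alpha> + 3 * (N + 2) powr \<alpha> + 3 * 4 powr \<alpha>)"
proof -
  obtain c w A H where s: "finite V" "card V = n" "c \<in> V" "w \<in> V - {c}" "A \<subseteq> V - {c, w}"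
    "H \<subseteq> pairs A" "card A + card H = 3"
    "platt \<alpha> E \<le> platt \<alpha> (hub c V \<union> ((\<lambda>x. {w, x}) ` A \<union> H))"
    by (rule cyclic_class_le_hub[OF assms \<alpha>]) auto
  have "finite A" using s finite_subset by blast
  then consider x y z where "A = {x, y, z}" "distinct [x, y, z]" "H = {}"
    | x y where "A = {x, y}" "x \<noteq> y" "H = {{x, y}}"
    using core_cases(3)[OF _ s(6,7)] by auto
  then show ?thesis
  proof cases
    case (1 x y z)
    then have "{w, x, y, z} \<subseteq> V - {c}" "distinct [w, x, y, z]" using s by auto
    from platt_G4[OF s(1,3) this, of \<alpha>] s 1 show ?thesis by (simp add: N_def)
  next
    case (2 x y)
    then have "{w, x, y} \<subseteq> V - {c}" "distinct [w, x, y]" using s by auto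
    moreover have "(\<lambda>x. {w, x}) ` A \<union> H = {{w, x}, {w, y}, {x, y}}" using 2 by auto
    ultimately show ?thesis using platt_G5[OF s(1,3), of w x y \<alpha>] s(2,8) by (simp add: N_def)
  qed
qed

text \<open>If \<open>A\<close> has four elements, then together with \<open>c\<close> and
  \<open>w\<close> there are at least six vertices. Recording \<open>n \<ge> 6\<close> in the first
  alternative lets the result serve both \<open>n = 5\<close> and larger \<open>n\<close>.\<close>

lemma platt_tetracyclic_cases:
  assumes "is_tetracyclic n V E"
  shows "n \<ge> 6 \<and> platt \<alpha> E \<le>
      (real n - 6) * N powr \<alpha> + 4 * (N + 1) powr \<alpha> + (N + 4) powr \<alpha> + 4 * 5 powr \<alpha> \<or>
    platt \<alpha> E \<le> (real n - 5) * N powr \<alpha> + (N + 1) powr \<alpha> + 2 * (N + 2) powr \<alpha> + (N + 3) powr \<alpha>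
      + 2 * 5 powr \<alpha> + 2 * 4 powr \<alpha>"
proof -
  obtain c w A H where s: "finite V" "card V = n" "c \<in> V" "w \<in> V - {c}" "A \<subseteq> V - {c, w}"
    "H \<subseteq> pairs A" "card A + card H = 4"
    "platt \<alpha> E \<le> platt \<alpha> (hub c V \<union> ((\<lambda>x. {w, x}) ` A \<union> H))"
    by (rule cyclic_class_le_hub[OF assms \<alpha>]) auto
  have "finite A" using s finite_subset by blast
  then consider x y z t where "A = {x, y, z, t}" "distinct [x, y, z, t]" "H = {}"
    | x y z where "A = {x, y, z}" "distinct [x, y, z]" "H = {{x, y}}"
    using core_cases(4)[OF _ s(6,7)] by auto
  then show ?thesis
  proof cases
    case (1 x y z t)
    then have d: "{w, x, y, z, t} \<subseteq> V - {c}" "distinct [w, x, y, z, t]" using s by auto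
    have "card {w, x, y, z, t} \<le> card (V - {c})" using d(1) s(1) by (intro card_mono) auto
    then have "6 \<le> n" using d(2) s(1-3) by simp
    with platt_H4[OF s(1,3) d, of \<alpha>] s 1 show ?thesis by (simp add: N_def)
  next
    case (2 x y z)
    then have "{w, x, y, z} \<subseteq> V - {c}" "distinct [w, x, y, z]" using s by auto
    moreover have "(\<lambda>x. {w, x}) ` A \<union> H = {{w, x}, {w, y}, {w, z}, {x, y}}" using 2 by auto
    ultimately show ?thesis using platt_H5[OF s(1,3), of w x y z \<alpha>] s(2,8) by (simp add: N_def)
  qed
qed

end

section \<open>The concrete graphs on \<open>verts n\<close>\<close>

lemma star_E_eq_hub: "star_E n = hub 0 (verts n)"
  by (auto simp: star_E_def hub_def verts_def)

lemma verts_facts: "finite (verts n)" "card (verts n) = n" "i \<in> verts n \<longleftrightarrow> i < n"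
  by (auto simp: verts_def)

lemma cyclic_class_star_add:
  assumes "n \<ge> 1" "simple_graph (verts n - {0}) H" "card H = k"
  shows "cyclic_class k n (verts n) (star_E n \<union> H)"
  using cyclic_class_hub[of "verts n" 0 H] assms by (simp add: verts_facts star_E_eq_hub)

context
  fixes \<alpha> :: real and n :: nat and N :: real
  defines "N \<equiv> real n - 2"
begin

lemma star_E_class: "n \<ge> 1 \<Longrightarrow> is_tree n (verts n) (star_E n)"
  using cyclic_class_star_add[of n "{}" 0] by (simp add: simple_graph_doubletons verts_facts)

lemma platt_star_E: "n \<ge> 1 \<Longrightarrow> platt \<alpha> (star_E n) = (real n - 1) * N powr \<alpha>"
  using platt_star[of "verts n" 0 \<alpha>] by (simp add: star_E_eq_hub verts_facts N_def)

lemma Splus_E_class: "n \<ge> 3 \<Longrightarrow> is_unicyclic n (verts n) (Splus_E n)"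
  unfolding Splus_E_def
  by (rule cyclic_class_star_add) (auto simp: simple_graph_doubletons verts_facts)

lemma platt_Splus_E:
  "n \<ge> 3 \<Longrightarrow> platt \<alpha> (Splus_E n) = (real n - 3) * N powr \<alpha> + 2 * (N + 1) powr \<alpha> + 2 powr \<alpha>"
  using platt_Splus[of "verts n" 0 1 2 \<alpha>]
  by (simp add: Splus_E_def star_E_eq_hub verts_facts N_def)

lemma B1_E_class: "n \<ge> 4 \<Longrightarrow> is_bicyclic n (verts n) (B1_E n)"
  unfolding B1_E_def
  by (rule cyclic_class_star_add) (auto simp: simple_graph_doubletons verts_facts doubleton_eq_iff)

lemma platt_B1_E:
  "n \<ge> 4 \<Longrightarrow> platt \<alpha> (B1_E n) =
    (real n - 4) * N powr \<alpha> + 2 * (N + 1) powr \<alpha> + (N + 2) powr \<alpha> + 2 * 3 powr \<alpha>"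
  using platt_B1[of "verts n" 0 1 2 3 \<alpha>]
  by (simp add: B1_E_def star_E_eq_hub verts_facts N_def)

lemma G4_E_class: "n \<ge> 5 \<Longrightarrow> is_tricyclic n (verts n) (G4_E n)"
  unfolding G4_E_def
  by (rule cyclic_class_star_add) (auto simp: simple_graph_doubletons verts_facts doubleton_eq_iff)

lemma platt_G4_E:
  "n \<ge> 5 \<Longrightarrow> platt \<alpha> (G4_E n) =
    (real n - 5) * N powr \<alpha> + 3 * (N + 1) powr \<alpha> + (N + 3) powr \<alpha> + 3 * 4 powr \<alpha>"
  using platt_G4[of "verts n" 0 1 2 3 4 \<alpha>]
  by (simp add: G4_E_def star_E_eq_hub verts_facts N_def)

lemma G5_E_class: "n \<ge> 5 \<Longrightarrow> is_tricyclic n (verts n) (G5_E n)"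
  unfolding G5_E_def
  by (rule cyclic_class_star_add) (auto simp: simple_graph_doubletons verts_facts doubleton_eq_iff)

lemma platt_G5_E:
  "n \<ge> 5 \<Longrightarrow> platt \<alpha> (G5_E n) =
    (real n - 4) * N powr \<alpha> + 3 * (N + 2) powr \<alpha> + 3 * 4 powr \<alpha>"
  using platt_G5[of "verts n" 0 1 2 3 \<alpha>]
  by (simp add: G5_E_def star_E_eq_hub verts_facts N_def insert_commute)

lemma H4_E_class: "n \<ge> 6 \<Longrightarrow> is_tetracyclic n (verts n) (H4_E n)"
  unfolding H4_E_def
  by (rule cyclic_class_star_add) (auto simp: simple_graph_doubletons verts_facts doubleton_eq_iff)

lemma platt_H4_E:
  "n \<ge> 6 \<Longrightarrow> platt \<alpha> (H4_E n) =
    (real n - 6) * N powr \<alpha> + 4 * (N + 1) powr \<alpha> + (N + 4) powr \<alpha> + 4 * 5 powr \<alpha>"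
  using platt_H4[of "verts n" 0 1 2 3 4 5 \<alpha>]
  by (simp add: H4_E_def star_E_eq_hub verts_facts N_def)

lemma H5_E_class: "n \<ge> 5 \<Longrightarrow> is_tetracyclic n (verts n) (H5_E n)"
  unfolding H5_E_def
  by (rule cyclic_class_star_add) (auto simp: simple_graph_doubletons verts_facts doubleton_eq_iff)

lemma platt_H5_E:
  assumes "n \<ge> 5"
  shows "platt \<alpha> (H5_E n) =
    (real n - 5) * N powr \<alpha> + (N + 1) powr \<alpha> + 2 * (N + 2) powr \<alpha> + (N + 3) powr \<alpha>
      + 2 * 5 powr \<alpha> + 2 * 4 powr \<alpha>"
proof -
  \<comment> \<open>The edges at vertex 1, which plays the role of \<open>w\<close>, are listed
    first as in \<open>platt_H5\<close>.\<close>
  have "{{1, 2}, {2, 3}, {3, 1}, {1, 4}} = {{1, 2}, {1, 3}, {1, 4}, {2, 3 :: nat}}" by auto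
  then show ?thesis
    using platt_H5[of "verts n" 0 1 2 3 4 \<alpha>] assms
    by (simp add: H5_E_def star_E_eq_hub verts_facts N_def)
qed

end

text \<open>The second alternative of \<open>platt_tetracyclic_cases\<close> is absorbed by
  \<open>powr_H5_le_H4\<close>, whose condition \<open>N \<ge> 4\<close> is
  \<open>n \<ge> 6\<close>.\<close>

lemma platt_tetracyclic_le_H4:
  assumes "\<alpha> \<ge> 1" "n \<ge> 6" "is_tetracyclic n V E"
  shows "platt \<alpha> E \<le> platt \<alpha> (H4_E n)"
proof -
  define N where "N = real n - 2"
  have "(real n - 5) * N powr \<alpha> = (real n - 6) * N powr \<alpha> + N powr \<alpha>" by (simp add: algebra_simps)
  then show ?thesis
    using platt_tetracyclic_cases[OF assms(1,3)] powr_H5_le_H4[of N \<alpha>] assms(1,2)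
    unfolding platt_H4_E[OF assms(2)] N_def[symmetric] by (auto simp: N_def)
qed

text \<open>The terms with base 4 cancel, and what remains is the third difference at
  \<open>n - 2\<close>, so \<open>powr_third_diff\<close> decides between the two graphs.\<close>

lemma platt_G4_G5_diff:
  assumes "n \<ge> 5"
  defines "N \<equiv> real n - 2"
  shows "platt \<alpha> (G4_E n) - platt \<alpha> (G5_E n) =
    (N + 3) powr \<alpha> + 3 * (N + 1) powr \<alpha> - (3 * (N + 2) powr \<alpha> + N powr \<alpha>)"
  unfolding platt_G4_E[OF assms(1)] platt_G5_E[OF assms(1)] N_def[symmetric]
  by (simp add: algebra_simps)

text \<open>The competing graphs have vertices of an arbitrary type and the maximizers have natural
  numbers as vertices; only the values of the index are compared.\<close>

theorem theorem7:
  fixes \<alpha> :: real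
  assumes "\<alpha> \<ge> 1"
  shows
  "(\<forall>n \<ge> 1. is_tree n (verts n) (star_E n) \<and>
      (\<forall>(V :: 'a set) E. is_tree n V E \<longrightarrow> platt \<alpha> E \<le> platt \<alpha> (star_E n)))
 \<and> (\<forall>n \<ge> 3. is_unicyclic n (verts n) (Splus_E n) \<and>
      (\<forall>(V :: 'a set) E. is_unicyclic n V E \<longrightarrow> platt \<alpha> E \<le> platt \<alpha> (Splus_E n)))
 \<and> (\<forall>n \<ge> 4. is_bicyclic n (verts n) (B1_E n) \<and>
      (\<forall>(V :: 'a set) E. is_bicyclic n V E \<longrightarrow> platt \<alpha> E \<le> platt \<alpha> (B1_E n)))
 \<and> (\<forall>n \<ge> 5. is_tricyclic n (verts n) (G4_E n) \<and> is_tricyclic n (verts n) (G5_E n) \<and>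
      (\<forall>(V :: 'a set) E. is_tricyclic n V E \<longrightarrow>
          platt \<alpha> E \<le> max (platt \<alpha> (G4_E n)) (platt \<alpha> (G5_E n))) \<and>
      (1 < \<alpha> \<and> \<alpha> < 2 \<longrightarrow> platt \<alpha> (G4_E n) < platt \<alpha> (G5_E n)) \<and>
      (\<alpha> > 2 \<longrightarrow> platt \<alpha> (G4_E n) > platt \<alpha> (G5_E n)) \<and>
      (\<alpha> = 1 \<or> \<alpha> = 2 \<longrightarrow> platt \<alpha> (G4_E n) = platt \<alpha> (G5_E n)))
 \<and> (\<forall>n \<ge> 6. is_tetracyclic n (verts n) (H4_E n) \<and>
      (\<forall>(V :: 'a set) E. is_tetracyclic n V E \<longrightarrow> platt \<alpha> E \<le> platt \<alpha> (H4_E n)))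
 \<and> (is_tetracyclic 5 (verts 5) (H5_E 5) \<and>
      (\<forall>(V :: 'a set) E. is_tetracyclic 5 V E \<longrightarrow> platt \<alpha> E \<le> platt \<alpha> (H5_E 5)))"
proof (intro conjI allI impI)
  fix n :: nat
  {
    assume n: "n \<ge> 1"
    show "is_tree n (verts n) (star_E n)" by (rule star_E_class[OF n])
    show "platt \<alpha> E \<le> platt \<alpha> (star_E n)" if "is_tree n V E" for V :: "'a set" and E
      unfolding platt_star_E[OF n] using platt_tree_le[OF assms that] .
  next
    assume n: "n \<ge> 3"
    show "is_unicyclic n (verts n) (Splus_E n)" by (rule Splus_E_class[OF n])
    show "platt \<alpha> E \<le> platt \<alpha> (Splus_E n)" if "is_unicyclic n V E" for V :: "'a set" and E
      unfolding platt_Splus_E[OF n] using platt_unicyclic_le[OF assms that] .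
  next
    assume n: "n \<ge> 4"
    show "is_bicyclic n (verts n) (B1_E n)" by (rule B1_E_class[OF n])
    show "platt \<alpha> E \<le> platt \<alpha> (B1_E n)" if "is_bicyclic n V E" for V :: "'a set" and E
      unfolding platt_B1_E[OF n] using platt_bicyclic_le[OF assms that] .
  next
    assume n: "n \<ge> 5"
    show "is_tricyclic n (verts n) (G4_E n)" by (rule G4_E_class[OF n])
    show "is_tricyclic n (verts n) (G5_E n)" by (rule G5_E_class[OF n])
    show "platt \<alpha> E \<le> max (platt \<alpha> (G4_E n)) (platt \<alpha> (G5_E n))"
      if "is_tricyclic n V E" for V :: "'a set" and E
      unfolding platt_G4_E[OF n] platt_G5_E[OF n] using platt_tricyclic_le[OF assms that] .
    have "real n - 2 > 0" using n by simp
    note T = powr_third_diff[OF this, of \<alpha>, folded platt_G4_G5_diff[OF n]]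
    show "platt \<alpha> (G4_E n) < platt \<alpha> (G5_E n)" if "1 < \<alpha> \<and> \<alpha> < 2"
      using T(2) that by simp
    show "platt \<alpha> (G5_E n) < platt \<alpha> (G4_E n)" if "\<alpha> > 2"
      using T(1) that by simp
    show "platt \<alpha> (G4_E n) = platt \<alpha> (G5_E n)" if "\<alpha> = 1 \<or> \<alpha> = 2"
      using T(3) that by simp
  next
    assume n: "n \<ge> 6"
    show "is_tetracyclic n (verts n) (H4_E n)" by (rule H4_E_class[OF n])
    show "platt \<alpha> E \<le> platt \<alpha> (H4_E n)" if "is_tetracyclic n V E" for V :: "'a set" and E
      using platt_tetracyclic_le_H4[OF assms n that] .
  }
  show "is_tetracyclic 5 (verts 5) (H5_E 5)" by (rule H5_E_class) simp
  show "platt \<alpha> E \<le> platt \<alpha> (H5_E 5)" if "is_tetracyclic 5 V E" for V :: "'a set" and E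
    \<comment> \<open>For five vertices the alternative with \<open>n \<ge> 6\<close> is
      void.\<close>
    using platt_tetracyclic_cases[OF assms that] platt_H5_E[of 5 \<alpha>] by simp
qed

end
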